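(* Run Algorithm PMR (defined in the context) with parameters $\gamma\ge 1$ and $0<R^*<1/2$ on an instance, and suppose that at the end of the peel-off phase $R>R^*$. Then $$ALG_P+ALG_R\ \ge\ nW\cdot\Big(\frac{2}{3}+\frac{\gamma-1}{3\gamma}R^*+\frac{1}{12\gamma}{R^*}^2\Big).$$
   Context: Instance: a finite set $V$ of $n$ items (vertices of $G=(V,E)$) with nonnegative dissimilarity weights $w_{i,j}=w_{j,i}$; $W=\sum_{(i,j)\in E}w_{i,j}$. A hierarchical clustering tree $T$ is a rooted tree with leaf set $V$; $T_{i,j}$ is the subtree rooted at the least common ancestor of $i,j$ and $|T_{i,j}|$ its number of leaves; $Rev(T)=\sum_{i,j}w_{i,j}|T_{i,j}|$. Random Partitioning: recursively split every cluster with at least two items into two nonempty parts uniformly at random (each item independently and uniformly on one of two sides, repeating if a side is empty). Algorithm PMR with parameters $\gamma,R^*$: set $V_B\leftarrow V$, $E_B\leftarrow E$. While some $v\in V_B$ has $W_v=\sum_{u\in V_B,(v,u)\in E_B}w_{v,u}\ge\gamma\frac{2W}{n}$ (original $W,n$), choose $v^*$ with the largest $W_v$, split the current cluster $V_B$ into $\{v^*\}$ and $V_B\setminus\{v^*\}$, delete $v^*$ from $V_B$ and its incident edges from $E_B$ (peel-off phase). The deleted vertices are red, the edges with at least one red endpoint are red edges, of total weight $W_R$; $R=W_R/W$. If $R>R^*$, run Random Partitioning on $V_B$; otherwise run the Goemans–Williamson max-cut algorithm on $(V_B,E_B)$, split $V_B$ accordingly, and run Random Partitioning on both sides. Let $T$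 be the output tree. $ALG_P=\sum_{\text{red edges }(i,j)}w_{i,j}|T_{i,j}|$, and (in the case $R>R^*$) $ALG_R$ is the expected value of $\sum_{(i,j)\in E_B}w_{i,j}|T_{i,j}|$ over the randomness of Random Partitioning, with $E_B$ the edge set remaining after the peel-off phase. *)

theory Defs
  imports "HOL-Probability.Probability"
begin

text \<open>
  An instance is a finite graph with vertex set \<open>V\<close> and edge set \<open>E\<close>. An edge is the two-element
  set of its endpoints, and the weight function lives on edges, so that \<open>w {i, j} = w {j, i}\<close> is
  built in and every edge is counted once in a sum over \<open>E\<close>.
\<close>

definition clustering_instance :: "'a set \<Rightarrow> 'a set set \<Rightarrow> ('a set \<Rightarrow> real) \<Rightarrow> bool" where
  "clustering_instance V E w \<longleftrightarrow>
     finite V \<and> (\<forall>e\<in>E. e \<subseteq> V \<and> card e = 2) \<and> (\<forall>e\<in>E. 0 \<le> w e)"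

definition total_weight :: "('a set \<Rightarrow> real) \<Rightarrow> 'a set set \<Rightarrow> real" where
  "total_weight w E = (\<Sum>e\<in>E. w e)"

text \<open>
  All splits performed by the algorithms are into two clusters, so binary trees suffice. The items
  are the leaf labels; the set of leaves of \<open>T\<close> is \<open>set_htree T\<close>.
\<close>

datatype 'a htree = Leaf 'a | Node "'a htree" "'a htree"

definition num_leaves :: "'a htree \<Rightarrow> nat" where
  "num_leaves T = card (set_htree T)"

text \<open>\<open>lca_subtree T {i, j}\<close> is the subtree \<open>T\<^bsub>i,j\<^esub>\<close> rooted at the least common ancestor.\<close>

fun lca_subtree :: "'a htree \<Rightarrow> 'a set \<Rightarrow> 'a htree" where
  "lca_subtree (Leaf v) e = Leaf v"
| "lca_subtree (Node l r) e =
     (if e \<subseteq> set_htree l then lca_subtree l e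
      else if e \<subseteq> set_htree r then lca_subtree r e
      else Node l r)"

definition revenue_on :: "('a set \<Rightarrow> real) \<Rightarrow> 'a set set \<Rightarrow> 'a htree \<Rightarrow> real" where
  "revenue_on w F T = (\<Sum>e\<in>F. w e * real (num_leaves (lca_subtree T e)))"

text \<open>
  A fair coin is tossed for every item independently; repeating until both sides are nonempty
  amounts to conditioning on that event. The result is one of the two sides.
\<close>

definition random_split :: "'a set \<Rightarrow> 'a set pmf" where
  "random_split S =
     cond_pmf (map_pmf (\<lambda>c. {v \<in> S. c v}) (Pi_pmf S False (\<lambda>_. bernoulli_pmf (1/2))))
       {A. A \<noteq> {} \<and> A \<noteq> S}"

lemma set_pmf_random_split:
  assumes "card S \<ge> 2"
  shows "set_pmf (random_split S) = {A. A \<noteq> {} \<and> A \<subset> S}"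
proof -
  let ?q = "Pi_pmf S False (\<lambda>_. bernoulli_pmf (1/2))"
  let ?p = "map_pmf (\<lambda>c. {v \<in> S. c v}) ?q"
  let ?B = "{A. A \<noteq> {} \<and> A \<noteq> S}"
  have fin: "finite S" using assms card_ge_0_finite[of S] by linarith
  have bern: "set_pmf (bernoulli_pmf (1/2)) = UNIV" by (simp add: set_pmf_bernoulli)
  have q: "set_pmf ?q = {c. \<forall>v. v \<notin> S \<longrightarrow> c v = False}"
    by (simp only: set_Pi_pmf[OF fin] PiE_dflt_def o_def bern UNIV_I simp_thms)
  have p: "set_pmf ?p = Pow S"
  proof (intro equalityI subsetI)
    fix A assume A: "A \<in> Pow S"
    have c: "(\<lambda>v. v \<in> A) \<in> set_pmf ?q" unfolding q using A by blast
    have "A = {v \<in> S. v \<in> A}" using A by blast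
    from image_eqI[where f = "\<lambda>c. {v \<in> S. c v}", OF this c]
    show "A \<in> set_pmf ?p" unfolding set_map_pmf .
  next
    fix A assume "A \<in> set_pmf ?p"
    then show "A \<in> Pow S" by auto
  qed
  have "S \<noteq> {}" using assms by fastforce
  then obtain a where a: "a \<in> S" by blast
  have "card {a} = 1" by simp
  then have "{a} \<noteq> S" using assms by auto
  then have "{a} \<in> set_pmf ?p \<inter> ?B" unfolding p using a by blast
  then have "set_pmf ?p \<inter> ?B \<noteq> {}" by blast
  from set_cond_pmf[OF this] have "set_pmf (random_split S) = Pow S \<inter> ?B"
    unfolding random_split_def p .
  then show ?thesis by blast
qed

function random_partitioning :: "'a set \<Rightarrow> 'a htree pmf" where
  "random_partitioning S =
     (if card S \<ge> 2
      then do {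
        A \<leftarrow> random_split S;
        l \<leftarrow> random_partitioning A;
        r \<leftarrow> random_partitioning (S - A);
        return_pmf (Node l r)
      }
      else return_pmf (Leaf (the_elem S)))"
  by pat_completeness simp
termination
proof (relation "Wellfounded.measure card")
  fix S A :: "'a set"
  assume S: "card S \<ge> 2" and A: "A \<in> set_pmf (random_split S)"
  have fin: "finite S" using S card_ge_0_finite[of S] by linarith
  have *: "A \<noteq> {}" "A \<subset> S" using A set_pmf_random_split[OF S] by auto
  then show "(A, S) \<in> Wellfounded.measure card" by (simp only: in_measure psubset_card_mono[OF fin])
  have "S - A \<subset> S" using * by blast
  then show "(S - A, S) \<in> Wellfounded.measure card" by (simp only: in_measure psubset_card_mono[OF fin])
qed simp

declare random_partitioning.simps [simp del]

text \<open>The Goemans--Williamson algorithm: its semidefinite relaxation and its rounding step.\<close>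

definition sdp_feasible :: "'a set \<Rightarrow> ('a \<Rightarrow> 'a \<Rightarrow> real) \<Rightarrow> bool" where
  "sdp_feasible VB x \<longleftrightarrow> (\<forall>i\<in>VB. (\<Sum>k\<in>VB. (x i k)\<^sup>2) = 1)"

text \<open>The leading 1/4 is the usual 1/2, halved again because every edge occurs as \<open>(i, j)\<close> and \<open>(j, i)\<close>.\<close>

definition sdp_value ::
  "('a set \<Rightarrow> real) \<Rightarrow> 'a set \<Rightarrow> 'a set set \<Rightarrow> ('a \<Rightarrow> 'a \<Rightarrow> real) \<Rightarrow> real" where
  "sdp_value w VB EB x =
     1/4 * (\<Sum>i\<in>VB. \<Sum>j | j \<in> VB \<and> {i, j} \<in> EB. w {i, j} * (1 - (\<Sum>k\<in>VB. x i k * x j k)))"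

text \<open>
  \<open>p\<close> is the distribution of the cut found by the algorithm for some optimal solution \<open>x\<close> of the
  relaxation, a family of unit vectors with coordinates indexed by \<open>VB\<close>. The normal of the random
  hyperplane has independent standard normal coordinates, so its direction is uniform on the sphere.
\<close>

definition gw_cut ::
  "('a set \<Rightarrow> real) \<Rightarrow> 'a set \<Rightarrow> 'a set set \<Rightarrow> 'a set pmf \<Rightarrow> bool" where
  "gw_cut w VB EB p \<longleftrightarrow>
     (\<exists>x. sdp_feasible VB x \<and>
          (\<forall>y. sdp_feasible VB y \<longrightarrow> sdp_value w VB EB y \<le> sdp_value w VB EB x) \<and>
          (let M = (\<Pi>\<^sub>M k\<in>VB. density lborel std_normal_density) in
           \<forall>S. pmf p S =
             measure M {g \<in> space M. {i \<in> VB. 0 \<le> (\<Sum>k\<in>VB. x i k * g k)} = S}))"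

text \<open>
  \<open>peel_off w \<theta> VB EB vs VB' EB'\<close>: started on \<open>(VB, EB)\<close>, the peel-off phase with threshold \<open>\<theta>\<close> can
  delete exactly the vertices \<open>vs\<close>, in this order, and then stops in \<open>(VB', EB')\<close>. It is a relation
  because ties for the largest weighted degree may be broken arbitrarily.
\<close>

definition vertex_weight :: "('a set \<Rightarrow> real) \<Rightarrow> 'a set \<Rightarrow> 'a set set \<Rightarrow> 'a \<Rightarrow> real" where
  "vertex_weight w VB EB v = (\<Sum>u | u \<in> VB \<and> {v, u} \<in> EB. w {v, u})"

inductive peel_off ::
  "('a set \<Rightarrow> real) \<Rightarrow> real \<Rightarrow> 'a set \<Rightarrow> 'a set set \<Rightarrow> 'a list \<Rightarrow> 'a set \<Rightarrow> 'a set set \<Rightarrow> bool"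
  for w :: "'a set \<Rightarrow> real" and \<theta> :: real where
  stop: "(\<And>v. v \<in> VB \<Longrightarrow> vertex_weight w VB EB v < \<theta>) \<Longrightarrow> peel_off w \<theta> VB EB [] VB EB"
| peel: "v \<in> VB \<Longrightarrow> \<theta> \<le> vertex_weight w VB EB v \<Longrightarrow>
         (\<And>u. u \<in> VB \<Longrightarrow> vertex_weight w VB EB u \<le> vertex_weight w VB EB v) \<Longrightarrow>
         peel_off w \<theta> (VB - {v}) {e \<in> EB. v \<notin> e} vs VB' EB' \<Longrightarrow>
         peel_off w \<theta> VB EB (v # vs) VB' EB'"

text \<open>The tree that splits off the vertices of the list one by one and continues with \<open>T\<close>.\<close>

fun peel_tree :: "'a list \<Rightarrow> 'a htree \<Rightarrow> 'a htree" where
  "peel_tree [] T = T"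
| "peel_tree (v # vs) T = Node (Leaf v) (peel_tree vs T)"

definition red_edges :: "'a set set \<Rightarrow> 'a list \<Rightarrow> 'a set set" where
  "red_edges E vs = {e \<in> E. e \<inter> set vs \<noteq> {}}"

text \<open>
  Meaningful for positive total weight only. If the total weight is 0, the value is 0 here,
  so it never exceeds a positive \<open>R\<^sup>*\<close>.
\<close>

definition red_fraction :: "('a set \<Rightarrow> real) \<Rightarrow> 'a set set \<Rightarrow> 'a list \<Rightarrow> real" where
  "red_fraction w E vs = total_weight w (red_edges E vs) / total_weight w E"

text \<open>A cut with an empty side is not a split; \<open>VB\<close> is then partitioned at random as a whole.\<close>

definition partition_cut :: "'a set \<Rightarrow> 'a set \<Rightarrow> 'a htree pmf" where
  "partition_cut VB S =
     (if S = {} \<or> S = VB then random_partitioning VB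
      else do {
        l \<leftarrow> random_partitioning S;
        r \<leftarrow> random_partitioning (VB - S);
        return_pmf (Node l r)
      })"

text \<open>
  \<open>pmr V E w \<gamma> Rs vs VB EB p\<close>: the algorithm with parameters \<open>\<gamma>\<close> and \<open>R\<^sup>* = Rs\<close> can peel off the
  (red) vertices \<open>vs\<close>, leaving the cluster \<open>VB\<close> with edges \<open>EB\<close>, and \<open>p\<close> is then the distribution
  of its output tree. (\<open>VB\<close> is empty only if the total weight is 0.)
\<close>

definition pmr ::
  "'a set \<Rightarrow> 'a set set \<Rightarrow> ('a set \<Rightarrow> real) \<Rightarrow> real \<Rightarrow> real \<Rightarrow>
   'a list \<Rightarrow> 'a set \<Rightarrow> 'a set set \<Rightarrow> 'a htree pmf \<Rightarrow> bool" where
  "pmr V E w \<gamma> Rs vs VB EB p \<longleftrightarrow>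
     peel_off w (\<gamma> * (2 * total_weight w E / real (card V))) V E vs VB EB \<and>
     (if red_fraction w E vs > Rs
      then p = map_pmf (peel_tree vs) (random_partitioning VB)
      else (\<exists>c. gw_cut w VB EB c \<and>
                p = map_pmf (peel_tree vs) (bind_pmf c (partition_cut VB))))"

definition alg_P :: "('a set \<Rightarrow> real) \<Rightarrow> 'a set set \<Rightarrow> 'a list \<Rightarrow> 'a htree \<Rightarrow> real" where
  "alg_P w E vs T = revenue_on w (red_edges E vs) T"

definition alg_R :: "('a set \<Rightarrow> real) \<Rightarrow> 'a set set \<Rightarrow> 'a htree pmf \<Rightarrow> real" where
  "alg_R w EB p = measure_pmf.expectation p (\<lambda>T. revenue_on w EB T)"

end

theory Submission
  imports Defs
begin

text \<open>
  Under random partitioning of a cluster with \<open>m\<close> items, the last cluster containing a given pair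
  has expected size exactly \<open>2(m + 1)/3\<close>: each further item belongs to it with probability \<open>2/3\<close>.
  The weighted degrees of the successively peeled vertices are nonincreasing while the clusters
  shrink, so by the argument of Chebyshev's sum inequality the red edges of total weight \<open>R W\<close>
  earn at least their weight times the average cluster size. Since every peeled vertex removes
  weight at least \<open>2 \<gamma> W / n\<close>, at most \<open>R n / (2 \<gamma>)\<close> vertices are peeled, and the bound
  follows because the resulting lower estimate decreases in the number of peeled vertices and
  increases in \<open>R\<close>.
\<close>

section \<open>Random splits and the support of random partitioning\<close>

text \<open>Fair coins induce the uniform distribution on the power set, and conditioning it on an
  event leaves it uniform there. Expectations over a split thus become plain averages.\<close>

lemma random_split_eq_pmf_of_set:
  assumes "card S \<ge> 2"
  shows "random_split S = pmf_of_set (Pow S - {{}, S})"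
proof -
  have fin: "finite S" using assms card_ge_0_finite[of S] by linarith
  from assms obtain a where a: "a \<in> S" by fastforce
  moreover have "{a} \<noteq> S" using assms by auto
  ultimately have "{a} \<in> Pow S \<inter> {A. A \<noteq> {} \<and> A \<noteq> S}" by auto
  then have ne: "Pow S \<inter> {A. A \<noteq> {} \<and> A \<noteq> S} \<noteq> {}" by blast
  have "random_split S = cond_pmf (pmf_of_set (Pow S)) {A. A \<noteq> {} \<and> A \<noteq> S}"
    unfolding random_split_def using pmf_of_set_Pow_conv_bernoulli[OF fin] by simp
  also have "\<dots> = pmf_of_set (Pow S \<inter> {A. A \<noteq> {} \<and> A \<noteq> S})"
    (is "?p = ?q")
  proof (rule pmf_eqI)
    fix A
    have "pmf ?p A = (if A \<in> {A. A \<noteq> {} \<and> A \<noteq> S} then pmf (pmf_of_set (Pow S)) A /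
        measure (pmf_of_set (Pow S)) {A. A \<noteq> {} \<and> A \<noteq> S} else 0)"
      using fin ne by (intro pmf_cond) (simp add: Pow_not_empty)
    also have "\<dots> = pmf ?q A"
      using fin ne by (simp add: measure_pmf_of_set Pow_not_empty indicator_def card_Pow)
    finally show "pmf ?p A = pmf ?q A" .
  qed
  also have "Pow S \<inter> {A. A \<noteq> {} \<and> A \<noteq> S} = Pow S - {{}, S}" by auto
  finally show ?thesis .
qed

text \<open>Makes every integrability side condition below automatic.\<close>

lemma random_partitioning_finite_support:
  assumes "finite S"
  shows "finite (set_pmf (random_partitioning S))"
  using assms
proof (induction S rule: finite_psubset_induct)
  case (psubset S)
  show ?case
  proof (cases "card S \<ge> 2")
    case True
    have sp: "set_pmf (random_split S) = {A. A \<noteq> {} \<and> A \<subset> S}"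
      by (rule set_pmf_random_split[OF True])
    then have "finite (set_pmf (random_split S))"
      using psubset.hyps by (auto intro: finite_subset[of _ "Pow S"])
    moreover have "finite (set_pmf (random_partitioning A))"
      "finite (set_pmf (random_partitioning (S - A)))"
      if "A \<in> set_pmf (random_split S)" for A
      using that unfolding sp by (auto intro!: psubset.IH)
    ultimately show ?thesis
      using True by (subst random_partitioning.simps) auto
  next
    case False
    then show ?thesis by (subst random_partitioning.simps) auto
  qed
qed

text \<open>Nonemptiness matters: for \<open>S = {}\<close> the result is the default tree
  \<open>Leaf (the_elem {})\<close>, which still has one leaf.\<close>

lemma set_htree_random_partitioning:
  assumes "finite S" "S \<noteq> {}" "T \<in> set_pmf (random_partitioning S)"
  shows "set_htree T = S"
  using assms
proof (induction S arbitrary: T rule: finite_psubset_induct)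
  case (psubset S)
  show ?case
  proof (cases "card S \<ge> 2")
    case True
    have sp: "set_pmf (random_split S) = {A. A \<noteq> {} \<and> A \<subset> S}"
      by (rule set_pmf_random_split[OF True])
    from psubset.prems(2) True obtain A l r where A: "A \<in> set_pmf (random_split S)"
      and l: "l \<in> set_pmf (random_partitioning A)"
      and r: "r \<in> set_pmf (random_partitioning (S - A))" and T: "T = Node l r"
      by (subst (asm) random_partitioning.simps) auto
    have A': "A \<noteq> {}" "A \<subset> S" using A sp by auto
    then have "S - A \<subset> S" "S - A \<noteq> {}" by auto
    with A' l r have "set_htree l = A" "set_htree r = S - A"
      using psubset.IH by blast+
    then show ?thesis using T A' by auto
  next
    case False
    then have "card S = 1" using psubset.prems(1) psubset.hyps
      by (metis One_nat_def card_gt_0_iff less_2_cases linorder_not_less less_numeral_extra(3))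
    then obtain a where "S = {a}" by (auto simp: card_1_singleton_iff)
    then show ?thesis using psubset.prems(2) by (subst (asm) random_partitioning.simps) auto
  qed
qed

section \<open>Expected size of the last cluster containing a given pair\<close>

lemma sum_Pow_insert:
  fixes f :: "'a set \<Rightarrow> real"
  assumes "finite A" "x \<notin> A"
  shows "(\<Sum>B\<in>Pow (insert x A). f B) = (\<Sum>B\<in>Pow A. f B + f (insert x B))"
proof -
  have "inj_on (insert x) (Pow A)" using assms(2) by (auto simp: inj_on_def)
  moreover have "Pow A \<inter> insert x ` Pow A = {}" using assms(2) by auto
  ultimately show ?thesis
    using assms(1) by (simp add: Pow_insert sum.union_disjoint sum.reindex sum.distrib)
qed

text \<open>The two subtrees are drawn independently, so their joint law is
  \<open>pair_pmf P Q\<close>. In each case at most one component matters, and only its marginal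
  remains.\<close>

lemma expectation_lca_Node:
  assumes l: "\<And>t. t \<in> set_pmf P \<Longrightarrow> set_htree t = A"
    and r: "\<And>t. t \<in> set_pmf Q \<Longrightarrow> set_htree t = B"
  shows "measure_pmf.expectation
      (do { l \<leftarrow> P; r \<leftarrow> Q; return_pmf (Node l r) }) (\<lambda>T. real (num_leaves (lca_subtree T e))) =
    (if e \<subseteq> A then measure_pmf.expectation P (\<lambda>T. real (num_leaves (lca_subtree T e)))
     else if e \<subseteq> B then measure_pmf.expectation Q (\<lambda>T. real (num_leaves (lca_subtree T e)))
     else real (card (A \<union> B)))"
proof -
  let ?h = "\<lambda>T. real (num_leaves (lca_subtree T e))"
  have "measure_pmf.expectation (do { l \<leftarrow> P; r \<leftarrow> Q; return_pmf (Node l r) }) ?h =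
      measure_pmf.expectation (map_pmf (\<lambda>(l, r). Node l r) (pair_pmf P Q)) ?h"
    by (simp add: pair_pmf_def map_bind_pmf)
  also have "\<dots> = measure_pmf.expectation (pair_pmf P Q) (\<lambda>(l, r). ?h (Node l r))"
    by (simp add: case_prod_unfold)
  \<comment> \<open>On the support the leaf sets are \<open>A\<close> and \<open>B\<close>, so the
    branch taken by \<open>lca_subtree\<close> no longer depends on the sampled trees.\<close>
  also have "\<dots> = measure_pmf.expectation (pair_pmf P Q)
      (\<lambda>x. if e \<subseteq> A then ?h (fst x) else if e \<subseteq> B then ?h (snd x) else real (card (A \<union> B)))"
    using l r by (intro integral_cong_AE) (auto simp: AE_measure_pmf_iff num_leaves_def)
  also have "\<dots> = (if e \<subseteq> A then measure_pmf.expectation (map_pmf fst (pair_pmf P Q)) ?h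
     else if e \<subseteq> B then measure_pmf.expectation (map_pmf snd (pair_pmf P Q)) ?h
     else real (card (A \<union> B)))"
    by simp
  finally show ?thesis by (simp add: map_fst_pair_pmf map_snd_pair_pmf)
qed

text \<open>Induction over the first split. The sides \<open>A\<close> are grouped by their trace on
  the items other than \<open>i\<close> and \<open>j\<close>; within each group of four the average
  is already the claimed value.\<close>

lemma expectation_lca_random_partitioning:
  assumes "finite S" "i \<in> S" "j \<in> S" "i \<noteq> j"
  shows "measure_pmf.expectation (random_partitioning S)
    (\<lambda>T. real (num_leaves (lca_subtree T {i, j}))) = 2 * (real (card S) + 1) / 3"
  using assms
proof (induction S rule: finite_psubset_induct)
  case (psubset S)
  let ?h = "\<lambda>T. real (num_leaves (lca_subtree T {i, j}))"
  let ?m = "real (card S)"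
  define U where "U = S - {i, j}"
  define sp where "sp = Pow S - {{}, S}"
  \<comment> \<open>By the induction hypothesis, \<open>g A\<close> is the conditional expectation
    given the first side \<open>A\<close>. It is also defined at \<open>{}\<close> and
    \<open>S\<close>, so that the sum can run over all of \<open>Pow S\<close> first.\<close>
  define g where "g A = (if {i, j} \<subseteq> A then 2 * (real (card A) + 1) / 3
    else if {i, j} \<subseteq> S - A then 2 * (real (card (S - A)) + 1) / 3 else ?m)" for A
  let ?s = "\<lambda>A. do { l \<leftarrow> random_partitioning A; r \<leftarrow> random_partitioning (S - A);
    return_pmf (Node l r) }"
  have S: "S = insert i (insert j U)" and U: "i \<notin> U" "j \<notin> U" "finite U"
    using psubset unfolding U_def by auto
  have m: "card S = card U + 2" using S U psubset.prems by simp
  then have c2: "card S \<ge> 2" by simp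
  have "{i} \<in> sp" using psubset.prems unfolding sp_def by auto
  then have sp: "finite sp" "sp \<noteq> {}" using psubset.hyps unfolding sp_def by auto
  have node: "measure_pmf.expectation (?s A) ?h = g A" if "A \<in> sp" for A
  proof -
    have A: "A \<noteq> {}" "A \<subset> S" "S - A \<noteq> {}" "S - A \<subset> S"
      using that unfolding sp_def by auto
    then have fin: "finite A" "finite (S - A)"
      using psubset.hyps finite_subset by blast+
    have "measure_pmf.expectation (?s A) ?h =
      (if {i, j} \<subseteq> A then measure_pmf.expectation (random_partitioning A) ?h
       else if {i, j} \<subseteq> S - A then measure_pmf.expectation (random_partitioning (S - A)) ?h
       else real (card (A \<union> (S - A))))"
      by (intro expectation_lca_Node set_htree_random_partitioning A fin)
    also have "A \<union> (S - A) = S" using A by auto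
    finally show ?thesis
      using psubset.IH[OF A(2)] psubset.IH[OF A(4)] psubset.prems unfolding g_def by auto
  qed
  \<comment> \<open>The two sides separating the pair contribute \<open>card S\<close> each. The
    other two contribute \<open>2 * (card B + 3) / 3\<close> and
    \<open>2 * (card S - card B + 1) / 3\<close>, so \<open>card B\<close> cancels.\<close>
  have four: "g B + g (insert i B) + (g (insert j B) + g (insert i (insert j B))) =
      8 * (?m + 1) / 3" if "B \<subseteq> U" for B
  proof -
    have B: "i \<notin> B" "j \<notin> B" "finite B" "B \<subseteq> S" "card B \<le> card S"
      using that U S psubset.hyps by (auto intro: finite_subset card_mono)
    then have "real (card (S - B)) = ?m - real (card B)"
      by (simp add: card_Diff_subset of_nat_diff)
    then show ?thesis
      using B psubset.prems unfolding g_def by (simp add: field_simps)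
  qed
  have "sum g (Pow S) = (\<Sum>B\<in>Pow (insert i (insert j U)). g B)"
    by (simp flip: S)
  also have "\<dots> = (\<Sum>B\<in>Pow U. g B + g (insert i B) + (g (insert j B) + g (insert i (insert j B))))"
    using U psubset.prems(3) by (simp add: sum_Pow_insert)
  also have "\<dots> = (\<Sum>B\<in>Pow U. 8 * (?m + 1) / 3)"
    using four by (intro sum.cong) auto
  also have "\<dots> = 2 ^ card S * (2 * (?m + 1) / 3)"
    using U unfolding m by (simp add: card_Pow power_add)
  finally have tot: "sum g (Pow S) = 2 ^ card S * (2 * (?m + 1) / 3)" .
  \<comment> \<open>The two excluded sides have exactly the average value, so forbidding empty sides
    does not change the average.\<close>
  have ends: "g {} = 2 * (?m + 1) / 3" "g S = 2 * (?m + 1) / 3"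
    using psubset.prems unfolding g_def by auto
  have "S \<noteq> {}" using psubset.prems by auto
  then have "sum g sp = sum g (Pow S) - sum g {{}, S}"
    using psubset.hyps unfolding sp_def by (intro sum_diff) auto
  also have "\<dots> = (2 ^ card S - 2) * (2 * (?m + 1) / 3)"
    using \<open>S \<noteq> {}\<close> tot ends by (auto simp: field_simps)
  finally have sumg: "sum g sp = (2 ^ card S - 2) * (2 * (?m + 1) / 3)" .
  have "card sp = 2 ^ card S - 2"
    using psubset.hyps \<open>S \<noteq> {}\<close> unfolding sp_def by (subst card_Diff_subset) (auto simp: card_Pow)
  then have csp: "real (card sp) = 2 ^ card S - 2"
    using c2 power_increasing[of 1 "card S" "2 :: nat"] by (simp add: of_nat_diff)
  have "measure_pmf.expectation (random_partitioning S) ?h =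
      measure_pmf.expectation (pmf_of_set sp \<bind> ?s) ?h"
    using c2 random_split_eq_pmf_of_set[OF c2]
    by (subst random_partitioning.simps) (simp add: sp_def)
  also have "\<dots> = (\<Sum>A\<in>sp. measure_pmf.expectation (?s A) ?h /\<^sub>R real (card sp))"
    using sp psubset.hyps
    by (intro pmf_expectation_bind_pmf_of_set)
       (auto simp: sp_def intro!: random_partitioning_finite_support intro: finite_subset)
  also have "\<dots> = sum g sp / real (card sp)"
    using node by (simp add: divide_inverse mult.commute flip: sum_distrib_right)
  also have "\<dots> = 2 * (?m + 1) / 3"
    using sumg csp sp by (metis card_0_eq nonzero_mult_div_cancel_left of_nat_eq_0_iff)
  finally show ?case .
qed

section \<open>Weighted degrees and bookkeeping of the peel-off phase\<close>

lemma vertex_weight_eq_sum_incident: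
  assumes "\<forall>e\<in>E. e \<subseteq> V \<and> card e = 2"
  shows "vertex_weight w V E v = (\<Sum>e | e \<in> E \<and> v \<in> e. w e)"
proof -
  have "bij_betw (\<lambda>u. {v, u}) {u \<in> V. {v, u} \<in> E} {e \<in> E. v \<in> e}"
  proof (rule bij_betwI')
    fix x y assume "x \<in> {u \<in> V. {v, u} \<in> E}" "y \<in> {u \<in> V. {v, u} \<in> E}"
    then show "({v, x} = {v, y}) = (x = y)" by (auto simp: doubleton_eq_iff)
  next
    fix e assume e: "e \<in> {e \<in> E. v \<in> e}"
    then have "card e = 2" "e \<subseteq> V" using assms by auto
    then obtain x y where "e = {x, y}" by (auto simp: card_2_iff)
    with e \<open>e \<subseteq> V\<close> show "\<exists>x\<in>{u \<in> V. {v, u} \<in> E}. e = {v, x}"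
      by (auto simp: insert_commute)
  qed auto
  from sum.reindex_bij_betw[OF this, of w] show ?thesis
    unfolding vertex_weight_def by simp
qed

lemma clustering_instance_delete_vertex:
  assumes "clustering_instance V E w"
  shows "clustering_instance (V - {v}) {e \<in> E. v \<notin> e} w"
  using assms unfolding clustering_instance_def by auto

lemma clustering_instance_finite_edges:
  assumes "clustering_instance V E w"
  shows "finite E"
  using assms unfolding clustering_instance_def by (intro finite_subset[of E "Pow V"]) auto

lemma vertex_weight_delete_vertex_le:
  assumes "clustering_instance V E w"
  shows "vertex_weight w (V - {v}) {e \<in> E. v \<notin> e} u \<le> vertex_weight w V E u"
proof -
  have "finite V" "\<And>e. e \<in> E \<Longrightarrow> 0 \<le> w e"
    using assms unfolding clustering_instance_def by auto
  then show ?thesis unfolding vertex_weight_def by (intro sum_mono2) auto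
qed

text \<open>Each red edge is charged to the first peeled endpoint. Keeping \<open>f\<close> general
  serves both weights and revenues.\<close>

lemma sum_red_edges_Cons:
  fixes f :: "'a set \<Rightarrow> real"
  assumes "finite E"
  shows "sum f (red_edges E (v # vs)) =
    (\<Sum>e | e \<in> E \<and> v \<in> e. f e) + sum f (red_edges {e \<in> E. v \<notin> e} vs)"
proof -
  have "red_edges E (v # vs) = {e \<in> E. v \<in> e} \<union> red_edges {e \<in> E. v \<notin> e} vs"
    unfolding red_edges_def by auto
  then show ?thesis
    using assms unfolding red_edges_def by (simp, subst sum.union_disjoint) auto
qed

lemma peel_off_remainder:
  assumes "peel_off w \<theta> V E vs VB EB" "clustering_instance V E w"
  shows "set vs \<subseteq> V" "VB = V - set vs" "EB = {e \<in> E. e \<inter> set vs = {}}"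
    "card VB + length vs = card V" "clustering_instance VB EB w"
proof -
  from assms have "set vs \<subseteq> V \<and> VB = V - set vs \<and> EB = {e \<in> E. e \<inter> set vs = {}} \<and>
    card VB + length vs = card V \<and> clustering_instance VB EB w"
  proof (induction rule: peel_off.induct)
    case (peel v VB EB vs VB' EB')
    have "finite VB" using peel.prems unfolding clustering_instance_def by auto
    then have "card VB = Suc (card (VB - {v}))" using peel.hyps(1) by (rule card.remove)
    then show ?case
      using peel.IH clustering_instance_delete_vertex[OF peel.prems, of v] by auto
  qed auto
  then show "set vs \<subseteq> V" "VB = V - set vs" "EB = {e \<in> E. e \<inter> set vs = {}}"
    "card VB + length vs = card V" "clustering_instance VB EB w" by auto
qed

text \<open>A single remaining vertex has weighted degree 0, since there are no loops, and thus
  stays below a positive threshold.\<close>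

lemma peel_off_nonempty:
  assumes "peel_off w \<theta> V E vs VB EB" "clustering_instance V E w" "\<theta> > 0" "V \<noteq> {}"
  shows "VB \<noteq> {}"
  using assms
proof (induction rule: peel_off.induct)
  case (peel v VB EB vs VB' EB')
  have "VB - {v} \<noteq> {}"
  proof
    assume "VB - {v} = {}"
    then have "{u. u \<in> VB \<and> {v, u} \<in> EB} = {}"
      using peel.prems(1) unfolding clustering_instance_def by fastforce
    then have "vertex_weight w VB EB v = 0"
      unfolding vertex_weight_def by (simp only: sum.empty)
    then show False using peel.hyps(2) peel.prems(2) by simp
  qed
  then show ?case
    using peel.IH clustering_instance_delete_vertex[OF peel.prems(1)] peel.prems(2) by blast
qed auto

lemma set_htree_peel_tree: "set_htree (peel_tree vs T) = set vs \<union> set_htree T"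
  by (induction vs) auto

text \<open>An edge avoiding all peeled vertices always descends into the right subtree, so its
  revenue is decided by \<open>T\<close> alone.\<close>

lemma lca_subtree_peel_tree:
  assumes "e \<subseteq> set_htree T" "e \<inter> set vs = {}" "e \<noteq> {}"
  shows "lca_subtree (peel_tree vs T) e = lca_subtree T e"
  using assms by (induction vs) (auto simp: set_htree_peel_tree)

section \<open>Weight and revenue of the red edges\<close>

text \<open>Each peeled vertex makes at least \<open>\<theta>\<close> of new weight red; this bounds
  the number of peeled vertices.\<close>

lemma peel_off_red_weight_ge:
  assumes "peel_off w \<theta> V E vs VB EB" "clustering_instance V E w"
  shows "real (length vs) * \<theta> \<le> sum w (red_edges E vs)"
  using assms
proof (induction rule: peel_off.induct)
  case (peel v VB EB vs VB' EB')
  have "vertex_weight w VB EB v = (\<Sum>e | e \<in> EB \<and> v \<in> e. w e)"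
    using peel.prems unfolding clustering_instance_def by (intro vertex_weight_eq_sum_incident) auto
  then show ?case
    using peel.IH[OF clustering_instance_delete_vertex[OF peel.prems]] peel.hyps(2)
      sum_red_edges_Cons[OF clustering_instance_finite_edges[OF peel.prems], of w v vs]
    by (simp add: algebra_simps)
qed (simp add: red_edges_def)

text \<open>Deletions never increase a weighted degree, so \<open>M\<close> bounds the contribution
  of every later vertex too. It is applied with \<open>M\<close> the degree of the vertex peeled
  just before.\<close>

lemma peel_off_red_weight_le:
  assumes "peel_off w \<theta> V E vs VB EB" "clustering_instance V E w"
    "\<And>v. v \<in> V \<Longrightarrow> vertex_weight w V E v \<le> M"
  shows "sum w (red_edges E vs) \<le> real (length vs) * M"
  using assms
proof (induction rule: peel_off.induct)
  case (peel v VB EB vs VB' EB')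
  have "vertex_weight w VB EB v = (\<Sum>e | e \<in> EB \<and> v \<in> e. w e)"
    using peel.prems unfolding clustering_instance_def by (intro vertex_weight_eq_sum_incident) auto
  moreover have "sum w (red_edges {e \<in> EB. v \<notin> e} vs) \<le> real (length vs) * M"
    using peel.prems(2) vertex_weight_delete_vertex_le[OF peel.prems(1)]
    by (intro peel.IH clustering_instance_delete_vertex[OF peel.prems(1)])
       (meson DiffD1 order_trans)
  ultimately show ?case
    using peel.hyps(1) peel.prems(2)[of v]
      sum_red_edges_Cons[OF clustering_instance_finite_edges[OF peel.prems(1)], of w v vs]
    by (simp add: algebra_simps)
qed (simp add: red_edges_def)

text \<open>The factor is the average of the cluster sizes \<open>card V\<close>,
  \<open>card V - 1\<close>, ... at which the vertices are split off. Larger clusters come with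
  larger degrees, so the weighted sum is at least the total weight times this average.\<close>

lemma revenue_red_edges_ge:
  assumes "peel_off w \<theta> V E vs VB EB" "clustering_instance V E w" "set_htree T = VB"
  shows "sum w (red_edges E vs) * (real (card V) - (real (length vs) - 1) / 2)
    \<le> revenue_on w (red_edges E vs) (peel_tree vs T)"
  using assms
proof (induction rule: peel_off.induct)
  case (peel v VB EB vs VB' EB')
  let ?E = "{e \<in> EB. v \<notin> e}"
  let ?t = "peel_tree (v # vs) T" and ?t' = "peel_tree vs T"
  let ?D = "vertex_weight w VB EB v" and ?R = "sum w (red_edges ?E vs)"
  have inst: "finite VB" "\<forall>e\<in>EB. e \<subseteq> VB \<and> card e = 2" "\<forall>e\<in>EB. 0 \<le> w e"
    using peel.prems(1) unfolding clustering_instance_def by auto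
  have fin: "finite EB" by (rule clustering_instance_finite_edges[OF peel.prems(1)])
  have inst': "clustering_instance (VB - {v}) ?E w"
    by (rule clustering_instance_delete_vertex[OF peel.prems(1)])
  have D: "?D = (\<Sum>e | e \<in> EB \<and> v \<in> e. w e)"
    by (rule vertex_weight_eq_sum_incident[OF inst(2)])
  have n: "card VB = Suc (card (VB - {v}))" using inst(1) peel.hyps(1) by (rule card.remove)
  have leaves': "set_htree ?t' = VB - {v}"
    using peel_off_remainder(1,2)[OF peel.hyps(4) inst'] peel.prems(2) set_htree_peel_tree[of vs T]
    by auto
  \<comment> \<open>Splitting off \<open>v\<close> separates all its edges at the root, so each
    earns the full current cluster size.\<close>
  have lca_v: "num_leaves (lca_subtree ?t e) = card VB" if "e \<in> EB" "v \<in> e" for e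
  proof -
    have "\<not> e \<subseteq> {v}" using that inst(2) card_mono[of "{v}" e] by auto
    then have "lca_subtree ?t e = ?t" using that leaves' by auto
    then show ?thesis using leaves' peel.hyps(1) by (simp add: num_leaves_def insert_absorb)
  qed
  have lca_other: "lca_subtree ?t e = lca_subtree ?t' e" if "e \<in> ?E" for e
  proof -
    have "\<not> e \<subseteq> {v}" using that inst(2) card_mono[of "{v}" e] by auto
    moreover have "e \<subseteq> set_htree ?t'" using that inst(2) leaves' by auto
    ultimately show ?thesis by auto
  qed
  have "revenue_on w (red_edges EB (v # vs)) ?t =
      ?D * real (card VB) + revenue_on w (red_edges ?E vs) ?t'"
  proof -
    have "(\<Sum>e | e \<in> EB \<and> v \<in> e. w e * real (num_leaves (lca_subtree ?t e))) = ?D * real (card VB)"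
      unfolding D sum_distrib_right using lca_v by (intro sum.cong) auto
    moreover have "(\<Sum>e\<in>red_edges ?E vs. w e * real (num_leaves (lca_subtree ?t e))) =
        revenue_on w (red_edges ?E vs) ?t'"
      unfolding revenue_on_def using lca_other by (intro sum.cong) (auto simp: red_edges_def)
    ultimately show ?thesis
      unfolding revenue_on_def[of _ _ ?t] by (subst sum_red_edges_Cons[OF fin]) simp
  qed
  moreover have "?R * (real (card VB) - 1 - (real (length vs) - 1) / 2)
      \<le> revenue_on w (red_edges ?E vs) ?t'"
    using peel.IH[OF inst' peel.prems(2)] n by simp
  \<comment> \<open>The greedy choice enters here. With \<open>k = length vs\<close>, the induction
    step has slack \<open>(k * ?D - ?R) / 2\<close>, so this inequality is exactly what it
    needs.\<close>
  moreover have "?R \<le> real (length vs) * ?D"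
    using peel.hyps(3) vertex_weight_delete_vertex_le[OF peel.prems(1)]
    by (intro peel_off_red_weight_le[OF peel.hyps(4) inst']) (meson DiffD1 order_trans)
  moreover have "sum w (red_edges EB (v # vs)) = ?D + ?R"
    unfolding D by (rule sum_red_edges_Cons[OF fin])
  ultimately show ?case
    by (simp add: field_simps)
qed (simp add: red_edges_def revenue_on_def)

section \<open>Expected revenue of the remaining edges\<close>

lemma expected_revenue_random_partitioning:
  assumes "clustering_instance V E w"
  shows "measure_pmf.expectation (random_partitioning V) (revenue_on w E) =
    total_weight w E * (2 * (real (card V) + 1) / 3)"
proof -
  have V: "finite V" and E: "\<forall>e\<in>E. e \<subseteq> V \<and> card e = 2"
    using assms unfolding clustering_instance_def by auto
  have "measure_pmf.expectation (random_partitioning V) (revenue_on w E) =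
    (\<Sum>e\<in>E. w e * measure_pmf.expectation (random_partitioning V)
       (\<lambda>T. real (num_leaves (lca_subtree T e))))"
    unfolding revenue_on_def
    using random_partitioning_finite_support[OF V]
    by (subst Bochner_Integration.integral_sum) (auto intro!: integrable_measure_pmf_finite)
  also have "\<dots> = (\<Sum>e\<in>E. w e * (2 * (real (card V) + 1) / 3))"
  proof (intro sum.cong refl arg_cong2[where f = "(*)"])
    fix e assume "e \<in> E"
    with E obtain i j where "e = {i, j}" "i \<noteq> j" "i \<in> V" "j \<in> V"
      by (metis card_2_iff insert_subset)
    then show "measure_pmf.expectation (random_partitioning V)
       (\<lambda>T. real (num_leaves (lca_subtree T e))) = 2 * (real (card V) + 1) / 3"
      using expectation_lca_random_partitioning[OF V] by blast
  qed
  finally show ?thesis unfolding total_weight_def sum_distrib_right .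
qed

section \<open>Combining the two bounds\<close>

text \<open>The right-hand side is \<open>n * (2 / 3 + R / 3) - (2 / 3 - R / 6) * r\<close>,
  decreasing in \<open>r\<close> because \<open>R \<le> 1\<close>. Inserting the largest
  \<open>r = R * n / (2 * \<gamma>)\<close> gives the left-hand expression with \<open>R\<close> for
  \<open>Rs\<close>, and this is monotone in \<open>R\<close> because
  \<open>\<gamma> \<ge> 1\<close>.\<close>

lemma revenue_fraction_bound:
  fixes n r R Rs \<gamma> :: real
  assumes "0 < n" "1 \<le> \<gamma>" "0 < Rs" "Rs \<le> R" "R \<le> 1" "2 * \<gamma> * r \<le> R * n"
  shows "n * (2 / 3 + (\<gamma> - 1) / (3 * \<gamma>) * Rs + 1 / (12 * \<gamma>) * Rs\<^sup>2)
    \<le> R * (n - r / 2) + (1 - R) * (2 * (n - r) / 3)"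
proof -
  have "(\<gamma> - 1) / (3 * \<gamma>) * Rs \<le> (\<gamma> - 1) / (3 * \<gamma>) * R"
    using assms by (intro mult_left_mono) auto
  moreover have "1 / (12 * \<gamma>) * Rs\<^sup>2 \<le> 1 / (12 * \<gamma>) * R\<^sup>2"
    using assms by (intro mult_left_mono power_mono) auto
  ultimately have "n * (2 / 3 + (\<gamma> - 1) / (3 * \<gamma>) * Rs + 1 / (12 * \<gamma>) * Rs\<^sup>2)
    \<le> n * (2 / 3 + (\<gamma> - 1) / (3 * \<gamma>) * R + 1 / (12 * \<gamma>) * R\<^sup>2)"
    using assms by (intro mult_left_mono) auto
  also have "\<dots> = n * (2 / 3 + R / 3) - (2 / 3 - R / 6) * (R * n / (2 * \<gamma>))"
    using assms by (simp add: field_simps power2_eq_square)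
  also have "\<dots> \<le> n * (2 / 3 + R / 3) - (2 / 3 - R / 6) * r"
    using assms by (intro diff_mono mult_left_mono) (auto simp: field_simps)
  also have "\<dots> = R * (n - r / 2) + (1 - R) * (2 * (n - r) / 3)"
    by (simp add: field_simps)
  finally show ?thesis .
qed

theorem theorem4:
  fixes V :: "'a set" and E :: "'a set set" and w :: "'a set \<Rightarrow> real"
    and \<gamma> Rs :: real and vs :: "'a list" and VB :: "'a set" and EB :: "'a set set"
    and p :: "'a htree pmf" and T :: "'a htree"
  assumes "clustering_instance V E w"
    and "\<gamma> \<ge> 1" and "0 < Rs" and "Rs < 1 / 2"
    and "pmr V E w \<gamma> Rs vs VB EB p"
    and "red_fraction w E vs > Rs"
    and "T \<in> set_pmf p"
  shows "alg_P w E vs T + alg_R w EB p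
           \<ge> real (card V) * total_weight w E *
               (2 / 3 + (\<gamma> - 1) / (3 * \<gamma>) * Rs + 1 / (12 * \<gamma>) * Rs\<^sup>2)"
proof -
  let ?W = "total_weight w E" and ?n = "real (card V)" and ?r = "real (length vs)"
  let ?R = "red_fraction w E vs"
  let ?\<theta> = "\<gamma> * (2 * ?W / ?n)"
  have V: "finite V" and E: "\<forall>e\<in>E. e \<subseteq> V \<and> card e = 2" and w: "\<forall>e\<in>E. 0 \<le> w e"
    using assms(1) unfolding clustering_instance_def by auto
  have finE: "finite E" by (rule clustering_instance_finite_edges[OF assms(1)])
  have po: "peel_off w ?\<theta> V E vs VB EB"
    and p: "p = map_pmf (peel_tree vs) (random_partitioning VB)"
    using assms(5,6) unfolding pmr_def by auto
  have "?W \<ge> 0" using w unfolding total_weight_def by (simp add: sum_nonneg)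
  \<comment> \<open>Division by zero would make the red fraction 0, which does not exceed
    \<open>Rs\<close>.\<close>
  moreover have "?W \<noteq> 0" using assms(3,6) unfolding red_fraction_def by auto
  ultimately have W: "?W > 0" by simp
  then have "E \<noteq> {}" unfolding total_weight_def by auto
  then have "V \<noteq> {}" using E by fastforce
  then have n: "?n > 0" using V by (simp add: card_gt_0_iff)
  have \<theta>: "?\<theta> > 0" using assms(2) W n by simp
  note rem = peel_off_remainder[OF po assms(1)]
  have VB: "VB \<noteq> {}" by (rule peel_off_nonempty[OF po assms(1) \<theta> \<open>V \<noteq> {}\<close>])
  have finVB: "finite VB" using V rem(2) by simp
  have cVB: "real (card VB) = ?n - ?r" using rem(4) by linarith
  have "total_weight w (red_edges E vs) = ?R * ?W"
    using W unfolding red_fraction_def by simp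
  then have red: "sum w (red_edges E vs) = ?R * ?W" unfolding total_weight_def .
  have "EB = E - red_edges E vs" "red_edges E vs \<subseteq> E"
    using rem(3) unfolding red_edges_def by auto
  then have "?W = sum w (red_edges E vs) + sum w EB"
    using sum.subset_diff[of "red_edges E vs" E w] finE unfolding total_weight_def by simp
  then have black: "total_weight w EB = (1 - ?R) * ?W"
    using red unfolding total_weight_def by (simp add: left_diff_distrib)
  have "total_weight w EB \<ge> 0"
    using w rem(3) unfolding total_weight_def by (auto intro: sum_nonneg)
  then have R1: "?R \<le> 1" using black W by (simp add: zero_le_mult_iff)
  have "?r * ?\<theta> \<le> ?R * ?W"
    using peel_off_red_weight_ge[OF po assms(1)] red by simp
  then have r: "2 * \<gamma> * ?r \<le> ?R * ?n"
    using W n by (simp add: field_simps)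
  \<comment> \<open>The red revenue is bounded for every possible output tree, not only in
    expectation.\<close>
  obtain T' where T': "T = peel_tree vs T'" "T' \<in> set_pmf (random_partitioning VB)"
    using assms(7) p by auto
  have "set_htree T' = VB" by (rule set_htree_random_partitioning[OF finVB VB T'(2)])
  from revenue_red_edges_ge[OF po assms(1) this]
  have "?R * ?W * (?n - (?r - 1) / 2) \<le> alg_P w E vs T"
    unfolding alg_P_def T'(1) red .
  \<comment> \<open>Drops the surplus \<open>1 / 2\<close> in the average cluster size; the summand
    1 in the expected size for the remaining edges is dropped likewise below.\<close>
  moreover have "?R * ?W * (?n - ?r / 2) \<le> ?R * ?W * (?n - (?r - 1) / 2)"
    using assms(3,6) W by (intro mult_left_mono) auto
  ultimately have P: "?R * ?W * (?n - ?r / 2) \<le> alg_P w E vs T" by linarith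
  have "alg_R w EB p =
      measure_pmf.expectation (random_partitioning VB) (\<lambda>t. revenue_on w EB (peel_tree vs t))"
    unfolding alg_R_def p by simp
  also have "\<dots> = measure_pmf.expectation (random_partitioning VB) (revenue_on w EB)"
  proof (intro integral_cong_AE)
    show "AE t in random_partitioning VB. revenue_on w EB (peel_tree vs t) = revenue_on w EB t"
      unfolding AE_measure_pmf_iff
    proof
      fix t assume "t \<in> set_pmf (random_partitioning VB)"
      then have t: "set_htree t = VB" by (rule set_htree_random_partitioning[OF finVB VB])
      have "lca_subtree (peel_tree vs t) e = lca_subtree t e" if "e \<in> EB" for e
        using that rem(3) E t rem(5) unfolding clustering_instance_def
        by (intro lca_subtree_peel_tree) fastforce+
      then show "revenue_on w EB (peel_tree vs t) = revenue_on w EB t"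
        unfolding revenue_on_def by simp
    qed
  qed auto
  also have "\<dots> = (1 - ?R) * ?W * (2 * (?n - ?r + 1) / 3)"
    unfolding expected_revenue_random_partitioning[OF rem(5)] black cVB ..
  finally have "alg_R w EB p = (1 - ?R) * ?W * (2 * (?n - ?r + 1) / 3)" .
  moreover have "(1 - ?R) * ?W * (2 * (?n - ?r) / 3) \<le> (1 - ?R) * ?W * (2 * (?n - ?r + 1) / 3)"
    using R1 W by (intro mult_left_mono) auto
  ultimately have Rb: "(1 - ?R) * ?W * (2 * (?n - ?r) / 3) \<le> alg_R w EB p" by simp
  have "?n * ?W * (2 / 3 + (\<gamma> - 1) / (3 * \<gamma>) * Rs + 1 / (12 * \<gamma>) * Rs\<^sup>2)
      \<le> ?W * (?R * (?n - ?r / 2) + (1 - ?R) * (2 * (?n - ?r) / 3))"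
    using mult_left_mono[OF revenue_fraction_bound[OF n assms(2,3) _ R1 r], of ?W] W assms(6)
    by (simp add: mult_ac)
  also have "\<dots> \<le> alg_P w E vs T + alg_R w EB p"
    using add_mono[OF P Rb] by (simp add: distrib_left mult_ac)
  finally show ?thesis .
qed

end
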